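(* Let $m\ge 1$ be an integer, let $u_-=u_0<u_1<\cdots<u_m<u_{m+1}=u_+$ be real numbers, let $a_i>0$, $k_i>0$ for $i=0,\dots,m$ and $d_i\ge 0$ for $i=1,\dots,m$. Let $\Omega=\{\bar\xi=(\xi_1,\ldots,\xi_m)\in\mathbb{R}^m : \xi_1<\cdots<\xi_m\}$ and define $E:\Omega\to\mathbb{R}$ by $$E(\bar\xi)=-\sum_{i=0}^m k_i(u_{i+1}-u_i)\ln\bigl(F(\xi_{i+1}/a_i)-F(\xi_i/a_i)\bigr)+\sum_{i=1}^m \frac{d_i\xi_i^2}{4},$$ where $\xi_0=-\infty$, $\xi_{m+1}=+\infty$. Then for each $c>0$ the set $\Omega_c=\{\bar\xi\in\Omega : E(\bar\xi)\le c\}$ is compact. In particular, $E$ attains its minimal value on $\Omega$.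
   Context: $F(\xi)=\frac{1}{2\sqrt{\pi}}\int_{-\infty}^{\xi}e^{-s^2/4}\,ds$ for $\xi\in\mathbb{R}$, with the conventions $F(-\infty)=0$, $F(+\infty)=1$. *)

theory Defs
  imports "HOL-Analysis.Analysis"
begin

text \<open>The point \<open>(\<xi>\<^sub>1, \<dots>, \<xi>\<^sub>m)\<close> of \<open>\<real>\<^sup>m\<close> is the point \<open>x\<close> of \<^const>\<open>Euclidean_space\<close> \<open>m\<close> with
  \<open>x i = \<xi>\<^sub>i\<^sub>+\<^sub>1\<close> for \<open>i < m\<close> (and \<open>x i = 0\<close> for \<open>i \<ge> m\<close>).\<close>

definition F :: "ereal \<Rightarrow> real" where
  "F \<xi> = (if \<xi> = -\<infinity> then 0 else if \<xi> = \<infinity> then 1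
     else 1 / (2 * sqrt pi) * (LBINT s:{..real_of_ereal \<xi>}. exp (- (s\<^sup>2 / 4))))"

text \<open>\<open>node m x i\<close> is \<open>\<xi>\<^sub>i\<close> for \<open>0 \<le> i \<le> m + 1\<close>, including \<open>\<xi>\<^sub>0 = -\<infinity>\<close> and \<open>\<xi>\<^sub>m\<^sub>+\<^sub>1 = \<infinity>\<close>.\<close>

definition node :: "nat \<Rightarrow> (nat \<Rightarrow> real) \<Rightarrow> nat \<Rightarrow> ereal" where
  "node m x i = (if i = 0 then -\<infinity> else if i \<le> m then ereal (x (i - 1)) else \<infinity>)"

definition Omega :: "nat \<Rightarrow> (nat \<Rightarrow> real) set" where
  "Omega m = {x \<in> topspace (Euclidean_space m). \<forall>i. Suc i < m \<longrightarrow> x i < x (Suc i)}"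

definition E :: "nat \<Rightarrow> (nat \<Rightarrow> real) \<Rightarrow> (nat \<Rightarrow> real) \<Rightarrow> (nat \<Rightarrow> real) \<Rightarrow> (nat \<Rightarrow> real)
    \<Rightarrow> (nat \<Rightarrow> real) \<Rightarrow> real" where
  "E m u a k d x =
     - (\<Sum>i=0..m. k i * (u (i + 1) - u i) *
          ln (F (node m x (i + 1) / ereal (a i)) - F (node m x i / ereal (a i))))
     + (\<Sum>i=1..m. d i * (x (i - 1))\<^sup>2 / 4)"

end

theory Submission
  imports Defs "HOL-Probability.Distributions" "HOL-Probability.Distribution_Functions"
begin

text \<open>\<open>F\<close> is the distribution function of the normal law with variance 2; it is thus continuous,
  strictly increasing and has limits 0 and 1. As every summand of \<open>E\<close> is nonnegative, \<open>E \<le> c\<close>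
  bounds each increment of \<open>F\<close> from below by some \<open>\<delta>\<^sub>i > 0\<close>. The first and the last of these bounds
  confine all coordinates to a fixed interval, and the set of points of the resulting box whose
  increments are at least \<open>\<delta>\<^sub>i\<close> is compact and contained in \<open>\<Omega>\<close>, where \<open>E\<close> is continuous.\<close>

section \<open>The Gaussian law behind \<open>F\<close>\<close>

definition normal_law :: "real measure" where
  "normal_law = density lborel (normal_density 0 (sqrt 2))"

interpretation normal_law: real_distribution normal_law
proof -
  interpret prob_space normal_law
    unfolding normal_law_def by (rule prob_space_normal_density) simp
  show "real_distribution normal_law"
    by unfold_locales (simp_all add: normal_law_def)
qed

lemma measure_normal_law:
  assumes "A \<in> sets borel"
  shows "measure normal_law A = (LBINT s:A. normal_density 0 (sqrt 2) s)"
proof -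
  have int: "set_integrable lborel A (normal_density 0 (sqrt 2))"
    unfolding set_integrable_def using assms by (intro integrable_mult_indicator) auto
  have "emeasure normal_law A = (\<integral>\<^sup>+ s. ennreal (indicator A s *\<^sub>R normal_density 0 (sqrt 2) s) \<partial>lborel)"
    unfolding normal_law_def using assms
    by (subst emeasure_density) (auto intro!: nn_integral_cong split: split_indicator)
  also have "\<dots> = ennreal (LBINT s:A. normal_density 0 (sqrt 2) s)"
    unfolding set_lebesgue_integral_def
    by (rule nn_integral_eq_integral) (use int in \<open>auto simp: set_integrable_def\<close>)
  finally show ?thesis
    unfolding measure_def
    by (simp add: set_lebesgue_integral_def integral_nonneg_AE)
qed

text \<open>Standard deviation sqrt 2 turns the Gaussian exponent into s^2/4 and the normalising
  factor into 1 / (2 sqrt pi).\<close>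

lemma F_ereal: "F (ereal y) = cdf normal_law y"
proof -
  have "normal_density 0 (sqrt 2) = (\<lambda>s. 1 / (2 * sqrt pi) * exp (- (s\<^sup>2 / 4)))"
    by (auto simp: normal_density_def real_sqrt_mult)
  then show ?thesis
    by (simp add: F_def cdf_def measure_normal_law)
qed

lemma F_infinity [simp]: "F \<infinity> = 1" "F (- \<infinity>) = 0"
  by (simp_all add: F_def)

lemma F_nonneg: "0 \<le> F z" and F_le_1: "F z \<le> 1"
  by (cases z; simp add: F_ereal normal_law.cdf_nonneg normal_law.cdf_bounded_prob)+

lemma F_mono: "x \<le> y \<Longrightarrow> F (ereal x) \<le> F (ereal y)"
  by (simp add: F_ereal normal_law.cdf_nondecreasing)

text \<open>The density vanishes nowhere, so a null set of the law is also Lebesgue null.\<close>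

lemma measure_normal_law_pos:
  assumes "A \<in> sets borel" "emeasure lborel A \<noteq> 0"
  shows "measure normal_law A > 0"
proof (rule ccontr)
  assume "\<not> ?thesis"
  then have "emeasure normal_law A = 0"
    by (simp add: normal_law.emeasure_eq_measure zero_less_measure_iff)
  then have "A \<in> null_sets normal_law"
    using assms by (auto simp: null_sets_def)
  then have "AE s in lborel. s \<in> A \<longrightarrow> normal_density 0 (sqrt 2) s = 0"
    unfolding normal_law_def
    by (subst (asm) null_sets_density_iff)
       (auto elim!: eventually_mono simp: ennreal_eq_0_iff intro!: antisym)
  then have "AE s in lborel. s \<notin> A"
    by (rule eventually_mono) (use normal_density_pos[of "sqrt 2" 0] in \<open>auto simp: less_le\<close>)
  then show False
    using assms by (subst (asm) AE_iff_measurable[OF _ refl]) auto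
qed

lemma F_strict_mono:
  assumes "x < y"
  shows "F (ereal x) < F (ereal y)"
proof -
  have "measure normal_law {x<..y} > 0"
    using assms by (intro measure_normal_law_pos) auto
  then show ?thesis
    using normal_law.cdf_diff_eq[OF assms] by (simp add: F_ereal)
qed

lemma F_gt_0: "0 < F (ereal y)"
  using F_strict_mono[of "y - 1" y] F_nonneg[of "ereal (y - 1)"] by simp

lemma F_lt_1: "F (ereal y) < 1"
  using F_strict_mono[of y "y + 1"] F_le_1[of "ereal (y + 1)"] by simp

text \<open>A distribution function is continuous wherever its law has no atom, and a law with a
  Lebesgue density has none.\<close>

lemma continuous_on_F: "continuous_on UNIV (\<lambda>y. F (ereal y))"
proof -
  have "measure normal_law {y} = 0" for y
  proof -
    have "AE s in lborel. indicator {y} s *\<^sub>R normal_density 0 (sqrt 2) s = 0"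
      using AE_lborel_singleton[of y] by eventually_elim simp
    then show ?thesis
      by (simp add: measure_normal_law set_lebesgue_integral_def integral_eq_zero_AE
            del: indicator_simps real_scaleR_def)
  qed
  then have "isCont (cdf normal_law) y" for y
    by (simp add: normal_law.isCont_cdf)
  then show ?thesis
    by (simp add: F_ereal continuous_at_imp_continuous_on)
qed

text \<open>Since F tends to 0 at -infinity, values of at least \<delta> keep the argument away from
  there. Meant for the first increment, which is F(\<xi>_1/a_0).\<close>

lemma F_ge_imp_lower_bound:
  assumes "0 < \<delta>"
  obtains N where "\<And>y. \<delta> \<le> F (ereal y) \<Longrightarrow> N \<le> y"
proof -
  have "\<forall>\<^sub>F y in at_bot. F (ereal y) < \<delta>"
    using order_tendstoD(2)[OF normal_law.cdf_lim_at_bot assms] by (simp add: F_ereal)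
  then obtain N where "\<And>y. y \<le> N \<Longrightarrow> F (ereal y) < \<delta>"
    by (auto simp: eventually_at_bot_linorder)
  then show ?thesis
    using that[of N] by (meson linear not_le)
qed

text \<open>The counterpart at +infinity, meant for the last increment 1 - F(\<xi>_m/a_m).\<close>

lemma F_le_imp_upper_bound:
  assumes "0 < \<delta>"
  obtains N where "\<And>y. \<delta> \<le> 1 - F (ereal y) \<Longrightarrow> y \<le> N"
proof -
  have "\<forall>\<^sub>F y in at_top. F (ereal y) > 1 - \<delta>"
    using order_tendstoD(1)[OF normal_law.cdf_lim_at_top_prob, of "1 - \<delta>"] assms
    by (simp add: F_ereal)
  then obtain N where N: "\<And>y. N \<le> y \<Longrightarrow> F (ereal y) > 1 - \<delta>"
    by (auto simp: eventually_at_top_linorder)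
  show ?thesis
  proof (rule that)
    fix y assume "\<delta> \<le> 1 - F (ereal y)"
    then show "y \<le> N"
      using N[of y] by linarith
  qed
qed

section \<open>The arguments of the logarithms in \<open>E\<close>\<close>

definition increment :: "nat \<Rightarrow> (nat \<Rightarrow> real) \<Rightarrow> (nat \<Rightarrow> real) \<Rightarrow> nat \<Rightarrow> real" where
  "increment m a x i = F (node m x (i + 1) / ereal (a i)) - F (node m x i / ereal (a i))"

lemma F_node_0: "b > 0 \<Longrightarrow> F (node m x 0 / ereal b) = 0"
  by (simp add: node_def)

lemma F_node_Suc: "b > 0 \<Longrightarrow> j < m \<Longrightarrow> F (node m x (Suc j) / ereal b) = F (ereal (x j / b))"
  by (simp add: node_def)

lemma F_node_last: "b > 0 \<Longrightarrow> m < j \<Longrightarrow> F (node m x j / ereal b) = 1"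
  by (simp add: node_def)

lemma continuous_on_F_node:
  assumes "b > 0"
  shows "continuous_on UNIV (\<lambda>x. F (node m x j / ereal b))"
proof -
  consider "j = 0" | i where "j = Suc i" "i < m" | "m < j"
    by (metis not_less_eq linorder_neqE_nat not0_implies_Suc)
  then show ?thesis
  proof cases
    case (2 i)
    have "continuous_on UNIV (\<lambda>x::nat \<Rightarrow> real. F (ereal (x i / b)))"
      by (rule continuous_on_compose2[OF continuous_on_F]) (use assms in \<open>auto intro!: continuous_intros\<close>)
    then show ?thesis
      using assms 2 by (simp add: F_node_Suc)
  qed (use assms in \<open>simp_all add: F_node_0 F_node_last\<close>)
qed

lemma continuous_on_increment: "a i > 0 \<Longrightarrow> continuous_on UNIV (\<lambda>x. increment m a x i)"
  unfolding increment_def by (intro continuous_on_diff continuous_on_F_node)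

lemma increment_le_1: "increment m a x i \<le> 1"
  unfolding increment_def using F_nonneg F_le_1 by (smt (verit))

text \<open>Both nodes of an increment are divided by the same positive \<open>a i\<close>, so an
  inner increment inherits its sign from their order. The two outer ones use 0 < F < 1 at finite
  arguments.\<close>

lemma increment_pos:
  assumes "x \<in> Omega m" "i \<le> m" "a i > 0" "m \<ge> 1"
  shows "increment m a x i > 0"
proof -
  consider "i = 0" | j where "i = Suc j" "Suc j < m" | "i = m" "i > 0"
    using assms by (metis le_neq_implies_less not0_implies_Suc neq0_conv)
  then show ?thesis
  proof cases
    case 1
    then show ?thesis
      using assms F_gt_0 by (simp add: increment_def F_node_0 F_node_Suc)
  next
    case (2 j)
    then have "x j / a i < x (Suc j) / a i"
      using assms by (auto simp: Omega_def divide_strict_right_mono)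
    then show ?thesis
      using assms 2 F_strict_mono by (simp add: increment_def F_node_Suc)
  next
    case 3
    then obtain j where "m = Suc j"
      by (metis gr0_implies_Suc)
    then show ?thesis
      using assms 3 F_lt_1 by (simp add: increment_def F_node_Suc F_node_last)
  qed
qed

text \<open>Monotonicity of F lets the inner increments recover the strict order of the coordinates.
  This places sets cut out by bounds on increments inside \<open>Omega\<close>.\<close>

lemma in_Omega_if_increment_pos:
  assumes "x \<in> topspace (Euclidean_space m)"
    and "\<And>i. i \<le> m \<Longrightarrow> a i > 0" "\<And>i. i \<le> m \<Longrightarrow> increment m a x i > 0"
  shows "x \<in> Omega m"
  unfolding Omega_def
proof (safe intro!: assms(1))
  fix i assume i: "Suc i < m"
  then have "F (ereal (x i / a (Suc i))) < F (ereal (x (Suc i) / a (Suc i)))"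
    using assms(2)[of "Suc i"] assms(3)[of "Suc i"] by (simp add: increment_def F_node_Suc)
  then have "x i / a (Suc i) < x (Suc i) / a (Suc i)"
    using F_mono by (meson not_le)
  then show "x i < x (Suc i)"
    using assms(2)[of "Suc i"] i by (simp add: divide_less_cancel)
qed

lemma Omega_mono:
  assumes "x \<in> Omega m" "i \<le> j" "j < m"
  shows "x i \<le> x j"
  using assms(2,3)
proof (induction j rule: dec_induct)
  case (step j)
  then show ?case
    using assms(1) by (force simp: Omega_def)
qed simp

section \<open>Compactness in the product topology and continuity of \<open>E\<close>\<close>

lemma compactin_Euclidean_space_iff:
  "compactin (Euclidean_space m) S \<longleftrightarrow> compact S \<and> S \<subseteq> topspace (Euclidean_space m)"
  \<comment> \<open>\<open>Euclidean_space m\<close> is a subspace of the product space of all real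
    sequences, whose topology is that of the function type.\<close>
  by (simp add: Euclidean_space_def compactin_subtopology euclidean_product_topology)

lemma compact_box:
  fixes m :: nat and L U :: real
  shows "compact {x. (\<forall>i<m. L \<le> x i \<and> x i \<le> U) \<and> (\<forall>i\<ge>m. x i = 0)}" (is "compact ?B")
proof -
  \<comment> \<open>Tychonoff: the factors are intervals for the first m coordinates and {0} for the
    others.\<close>
  have "compactin (product_topology (\<lambda>i. euclidean) UNIV)
      (PiE UNIV (\<lambda>i. if i < m then {L..U} else {0::real}))"
    by (subst compactin_PiE) auto
  also have "PiE UNIV (\<lambda>i. if i < m then {L..U} else {0::real}) = ?B"
    by (auto simp: PiE_iff split: if_splits)
  finally show ?thesis
    by (simp add: euclidean_product_topology)
qed

lemma compact_sublevel_continuous: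
  fixes f :: "'a::topological_space \<Rightarrow> real"
  assumes "compact K" "closed K" "continuous_on K f"
  shows "compact {x \<in> K. f x \<le> c}"
proof -
  have "closed (f -` {..c} \<inter> K)"
    using assms by (simp add: continuous_on_closed_vimage)
  then have "compact (K \<inter> (f -` {..c} \<inter> K))"
    using assms by (simp add: compact_Int_closed)
  then show ?thesis
    by (simp add: vimage_def Int_def conj_commute conj_left_commute)
qed

lemma continuous_on_E:
  assumes "\<And>i. i \<le> m \<Longrightarrow> a i > 0" "\<And>x i. x \<in> S \<Longrightarrow> i \<le> m \<Longrightarrow> increment m a x i > 0"
  shows "continuous_on S (E m u a k d)"
proof -
  have "continuous_on S (\<lambda>x. - (\<Sum>i=0..m. k i * (u (i + 1) - u i) * ln (increment m a x i))
     + (\<Sum>i=1..m. d i * (x (i - 1))\<^sup>2 / 4))"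
    using assms
    by (intro continuous_intros continuous_on_subset[OF continuous_on_increment]
          continuous_on_subset[OF continuous_on_product_coordinates]) force+
  then show ?thesis
    by (simp add: E_def[abs_def] increment_def)
qed

section \<open>Sublevel sets and the minimum\<close>

context
  fixes m :: nat and u a k d :: "nat \<Rightarrow> real"
  assumes m: "m \<ge> 1"
    and u: "\<And>i. i \<le> m \<Longrightarrow> u i < u (i + 1)"
    and a: "\<And>i. i \<le> m \<Longrightarrow> a i > 0"
    and k: "\<And>i. i \<le> m \<Longrightarrow> k i > 0"
    and d: "\<And>i. 1 \<le> i \<Longrightarrow> i \<le> m \<Longrightarrow> d i \<ge> 0"
begin

text \<open>Increments are at most 1, so each logarithm is at most 0 and all the omitted summands
  are nonnegative.\<close>

lemma E_ge_summand:
  assumes "x \<in> Omega m" "j \<le> m"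
  shows "- (k j * (u (j + 1) - u j) * ln (increment m a x j)) \<le> E m u a k d x"
proof -
  define t where "t i = - (k i * (u (i + 1) - u i) * ln (increment m a x i))" for i
  have "t i \<ge> 0" if "i \<le> m" for i
    using increment_pos[of x m i a, OF assms(1) that a[OF that] m] increment_le_1[of m a x i] u[OF that] k[OF that]
    by (auto simp: t_def mult_nonneg_nonpos)
  then have "t j \<le> (\<Sum>i=0..m. t i)"
    using assms(2) by (intro member_le_sum) auto
  moreover have "0 \<le> (\<Sum>i=1..m. d i * (x (i - 1))\<^sup>2 / 4)"
    using d by (intro sum_nonneg) auto
  ultimately show ?thesis
    by (simp add: E_def t_def increment_def sum_negf)
qed

lemma increment_ge:
  assumes "x \<in> Omega m" "i \<le> m" "E m u a k d x \<le> c"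
  shows "exp (- (c / (k i * (u (i + 1) - u i)))) \<le> increment m a x i"
proof -
  define w where "w = k i * (u (i + 1) - u i)"
  have "w > 0"
    using u k assms(2) by (simp add: w_def)
  have "- (w * ln (increment m a x i)) \<le> c"
    using E_ge_summand[OF assms(1,2)] assms(3) by (simp add: w_def)
  then have "- (c / w) \<le> ln (increment m a x i)"
    using \<open>w > 0\<close> by (simp add: field_simps)
  then show ?thesis
    using increment_pos[of x m i a, OF assms(1,2) a[OF assms(2)] m] by (simp add: ln_ge_iff w_def)
qed

lemma compact_sublevel: "compact {x \<in> Omega m. E m u a k d x \<le> c}"
proof -
  define \<delta> where "\<delta> i = exp (- (c / (k i * (u (i + 1) - u i))))" for i
  have \<delta>: "\<delta> i > 0" for i
    by (simp add: \<delta>_def)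
  obtain L where L: "\<And>y. \<delta> 0 \<le> F (ereal y) \<Longrightarrow> L \<le> y"
    using F_ge_imp_lower_bound[OF \<delta>[of 0]] by blast
  obtain U where U: "\<And>y. \<delta> m \<le> 1 - F (ereal y) \<Longrightarrow> y \<le> U"
    using F_le_imp_upper_bound[OF \<delta>[of m]] by blast
  define B where "B = {x. (\<forall>i<m. L * a 0 \<le> x i \<and> x i \<le> U * a m) \<and> (\<forall>i\<ge>m. x i = 0)}"
  \<comment> \<open>Weak inequalities with a positive bound make a closed condition, while the
    strict order in \<open>Omega\<close> is in general not closed: the bounds \<delta> keep
    neighbouring coordinates from merging in a limit.\<close>
  define K where "K = B \<inter> (\<Inter>i\<in>{..m}. {x. \<delta> i \<le> increment m a x i})"
  have "compact B"
    unfolding B_def by (rule compact_box)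
  moreover have "closed (\<Inter>i\<in>{..m}. {x. \<delta> i \<le> increment m a x i})"
    using a by (intro closed_INT ballI closed_Collect_le continuous_on_increment) auto
  ultimately have "compact K"
    unfolding K_def by (rule compact_Int_closed)
  have K_pos: "increment m a x i > 0" if "x \<in> K" "i \<le> m" for x i
    using that \<delta>[of i] by (force simp: K_def)
  have K_sub: "K \<subseteq> Omega m"
  proof
    fix x assume "x \<in> K"
    then show "x \<in> Omega m"
      using a K_pos
      by (intro in_Omega_if_increment_pos[of x m a]) (auto simp: K_def B_def topspace_Euclidean_space)
  qed
  have "x \<in> K" if x: "x \<in> Omega m" and Ex: "E m u a k d x \<le> c" for x
  proof -
    have ge: "\<delta> i \<le> increment m a x i" if "i \<le> m" for i
      using increment_ge[OF x that Ex] by (simp add: \<delta>_def)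
    \<comment> \<open>The last coordinate has index l = m - 1. It is bounded above and coordinate 0
      below; the order of the coordinates then confines those in between.\<close>
    obtain l where l: "m = Suc l"
      using m by (metis Suc_le_D One_nat_def)
    have "L \<le> x 0 / a 0"
      using ge[of 0] m a[of 0] by (intro L) (simp add: increment_def F_node_0 F_node_Suc)
    moreover have "x l / a m \<le> U"
      using ge[of m] m a[of m] l by (intro U) (simp add: increment_def F_node_Suc F_node_last)
    ultimately have "L * a 0 \<le> x 0" "x l \<le> U * a m"
      using a[of 0] a[of m] by (simp_all add: field_simps)
    then have "L * a 0 \<le> x i \<and> x i \<le> U * a m" if "i < m" for i
      using Omega_mono[OF x, of 0 i] Omega_mono[OF x, of i l] that l by force
    then show ?thesis
      using x ge by (auto simp: K_def B_def Omega_def topspace_Euclidean_space)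
  qed
  \<comment> \<open>Points of \<open>K\<close> may have energy above c, so the sublevel set is cut
    out of \<open>K\<close>, on which \<open>E\<close> is continuous.\<close>
  with K_sub have "{x \<in> Omega m. E m u a k d x \<le> c} = {x \<in> K. E m u a k d x \<le> c}"
    by blast
  also have "compact \<dots>"
    using \<open>compact K\<close> a K_pos
    by (intro compact_sublevel_continuous continuous_on_E compact_imp_closed) auto
  finally show ?thesis .
qed

lemma E_attains_inf: "\<exists>x\<in>Omega m. \<forall>y\<in>Omega m. E m u a k d x \<le> E m u a k d y"
proof -
  \<comment> \<open>The point (0, 1, ..., m - 1) shows that \<open>Omega\<close> is inhabited; its
    level makes the sublevel set \<open>S\<close> nonempty.\<close>
  define p where "p i = (if i < m then real i else 0)" for i
  have p: "p \<in> Omega m"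
    by (simp add: p_def Omega_def topspace_Euclidean_space)
  define S where "S = {x \<in> Omega m. E m u a k d x \<le> E m u a k d p}"
  have "compact S" "S \<noteq> {}"
    using p compact_sublevel by (auto simp: S_def)
  moreover have "continuous_on S (E m u a k d)"
    using a m increment_pos by (intro continuous_on_E) (auto simp: S_def)
  ultimately obtain x where x: "x \<in> S" "\<forall>y\<in>S. E m u a k d x \<le> E m u a k d y"
    using continuous_attains_inf by blast
  have "E m u a k d x \<le> E m u a k d y" if "y \<in> Omega m" for y
  \<comment> \<open>Outside \<open>S\<close> the energy exceeds that of \<open>p\<close>, which is
    at least that of the minimiser over \<open>S\<close>.\<close>
  proof (cases "y \<in> S")
    case False
    then show ?thesis
      using x(1) that by (simp add: S_def)
  qed (use x(2) in blast)
  then show ?thesis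
    using x(1) by (auto simp: S_def)
qed

end

theorem theorem1p1:
  fixes m :: nat and u a k d :: "nat \<Rightarrow> real"
  assumes "m \<ge> 1"
    and "\<And>i. i \<le> m \<Longrightarrow> u i < u (i + 1)"
    and "\<And>i. i \<le> m \<Longrightarrow> a i > 0"
    and "\<And>i. i \<le> m \<Longrightarrow> k i > 0"
    and "\<And>i. 1 \<le> i \<Longrightarrow> i \<le> m \<Longrightarrow> d i \<ge> 0"
  shows "(\<forall>c>0. compactin (Euclidean_space m) {x \<in> Omega m. E m u a k d x \<le> c})
    \<and> (\<exists>x\<in>Omega m. \<forall>y\<in>Omega m. E m u a k d x \<le> E m u a k d y)"
proof (intro conjI allI impI)
  fix c :: real
  show "compactin (Euclidean_space m) {x \<in> Omega m. E m u a k d x \<le> c}"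
    using compact_sublevel[of m u a k d c, OF assms] by (auto simp: compactin_Euclidean_space_iff Omega_def)
qed (rule E_attains_inf[of m u a k d, OF assms])

end
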